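(* Let $(X,\mathcal{B}_X,\mu,T)$ be a $\mathbb{Z}^2$-measure preserving dynamical system and let $\vec{v}=(1,\beta)\in\mathbb{R}^2$ be a direction vector with $\beta$ irrational. Then $$L^2(X,\mathcal{B}_X,\mu)=WM^{\mu,\vec{v}}(X)\bigoplus L^2(X,\mathcal{K}_\mu^{\vec{v}},\mu),$$ as an orthogonal direct sum.
   Context: A $\mathbb{Z}^2$-measure preserving dynamical system $(X,\mathcal{B}_X,\mu,T)$ consists of a compact metric space $X$, its Borel $\sigma$-algebra $\mathcal{B}_X$, a group homomorphism $(m,n)\mapsto T^{(m,n)}$ from the additive group $\mathbb{Z}^2$ to the group of homeomorphisms of $X$, and a Borel probability measure $\mu$ invariant under every $T^{(m,n)}$. For $f\in L^2(X,\mathcal{B}_X,\mu)$, $U_T^{(m,n)}f=f\circ T^{(m,n)}$; $1_B$ is the indicator function of $B$. For $\vec{v}=(1,\beta)$ and $b\in(0,\infty)$, $\Lambda^{\vec{v}}(b)=\{(m,n)\in\mathbb{Z}^2:\beta m-b\le n\le\beta m+b\}$. The directional Kronecker algebra $\mathcal{K}_\mu^{\vec{v}}$ is the $\sigma$-algebra of all $B\in\mathcal{B}_X$ such that the closure of $\{U_T^{(m,n)}1_B:(m,n)\in\Lambda^{\vec{v}}(b)\}$ is compact in $L^2(X,\mathcal{B}_X,\mu)$; it does not depend on the choice of $b\in(0,\infty)$. A function $f\in L^2(X,\mathcal{B}_X,\mu)$ is $\vec{v}$-weakly mixing if $\mathbb{E}(f|\mathcal{K}_\mu^{\vec{v}})(x)=0$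 for $\mu$-a.e. $x\in X$, and $WM^{\mu,\vec{v}}(X)$ denotes the set of all $\vec{v}$-weakly mixing functions. *)

theory Defs
  imports "HOL-Probability.Probability"
begin

subsection \<open>Square-integrable functions\<close>

text \<open>
  Elements of \<open>L\<^sup>2\<close> are represented by square-integrable complex-valued functions.
  Functions that agree almost everywhere are at distance zero and are identified through
  \<open>AE\<close> wherever equality in \<open>L\<^sup>2\<close> matters.
\<close>

definition L2 :: "'a measure \<Rightarrow> ('a \<Rightarrow> complex) set" where
  "L2 M = {f \<in> borel_measurable M. integrable M (\<lambda>x. (cmod (f x))\<^sup>2)}"

definition L2_inner :: "'a measure \<Rightarrow> ('a \<Rightarrow> complex) \<Rightarrow> ('a \<Rightarrow> complex) \<Rightarrow> complex" where
  "L2_inner M f g = (LINT x|M. f x * cnj (g x))"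

definition L2_dist :: "'a measure \<Rightarrow> ('a \<Rightarrow> complex) \<Rightarrow> ('a \<Rightarrow> complex) \<Rightarrow> real" where
  "L2_dist M f g = sqrt (LINT x|M. (cmod (f x - g x))\<^sup>2)"

text \<open>
  The topology of the pseudometric \<open>L2_dist\<close>. Its open and its closed sets are saturated with
  respect to equality almost everywhere, so a set of functions has compact closure here if and
  only if the corresponding set of classes has compact closure in the quotient.
\<close>

definition L2_topology :: "'a measure \<Rightarrow> ('a \<Rightarrow> complex) topology" where
  "L2_topology M = topology (\<lambda>U. U \<subseteq> L2 M \<and>
     (\<forall>f\<in>U. \<exists>e>0. \<forall>g\<in>L2 M. L2_dist M f g < e \<longrightarrow> g \<in> U))"

definition L2_subspace :: "'a measure \<Rightarrow> ('a \<Rightarrow> complex) set \<Rightarrow> bool" where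
  "L2_subspace M V \<longleftrightarrow> V \<subseteq> L2 M \<and> (\<lambda>x. 0) \<in> V \<and>
     (\<forall>f\<in>V. \<forall>g\<in>V. (\<lambda>x. f x + g x) \<in> V) \<and> (\<forall>c. \<forall>f\<in>V. (\<lambda>x. c * f x) \<in> V)"

definition L2_orthogonal_direct_sum ::
    "'a measure \<Rightarrow> ('a \<Rightarrow> complex) set \<Rightarrow> ('a \<Rightarrow> complex) set \<Rightarrow> bool" where
  "L2_orthogonal_direct_sum M V W \<longleftrightarrow>
     L2_subspace M V \<and> L2_subspace M W \<and>
     (\<forall>g\<in>V. \<forall>h\<in>W. L2_inner M g h = 0) \<and>
     (\<forall>f\<in>L2 M. \<exists>g\<in>V. \<exists>h\<in>W. (AE x in M. f x = g x + h x) \<and>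
        (\<forall>g'\<in>V. \<forall>h'\<in>W. (AE x in M. f x = g' x + h' x) \<longrightarrow>
           (AE x in M. g' x = g x) \<and> (AE x in M. h' x = h x)))"

definition complex_cond_exp :: "'a measure \<Rightarrow> 'a measure \<Rightarrow> ('a \<Rightarrow> complex) \<Rightarrow> 'a \<Rightarrow> complex" where
  "complex_cond_exp M F f =
     (\<lambda>x. Complex (real_cond_exp M F (\<lambda>y. Re (f y)) x) (real_cond_exp M F (\<lambda>y. Im (f y)) x))"


subsection \<open>Measure preserving actions of the integer lattice and directional notions\<close>

locale Z2_mps = prob_space M
  for M :: "'a::metric_space measure" +
  fixes T :: "int \<times> int \<Rightarrow> 'a \<Rightarrow> 'a"
  assumes compact_UNIV: "compact (UNIV :: 'a set)"
    and sets_eq_borel: "sets M = sets borel"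
    and T_add: "T (p + q) = T p \<circ> T q"
    and T_homeomorphism: "\<exists>S. homeomorphism UNIV UNIV (T p) S"
    and T_invariant: "distr M M (T p) = M"

definition koopman :: "(int \<times> int \<Rightarrow> 'a \<Rightarrow> 'a) \<Rightarrow> int \<times> int \<Rightarrow> ('a \<Rightarrow> complex) \<Rightarrow> 'a \<Rightarrow> complex" where
  "koopman T p f = f \<circ> T p"

text \<open>The strip \<open>\<Lambda>\<^bsup>v\<^esup>(b)\<close> around the line in direction \<open>v = (1, \<beta>)\<close>.\<close>

definition direction_strip :: "real \<Rightarrow> real \<Rightarrow> (int \<times> int) set" where
  "direction_strip \<beta> b =
     {(m, n). \<beta> * real_of_int m - b \<le> real_of_int n \<and> real_of_int n \<le> \<beta> * real_of_int m + b}"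

definition directional_kronecker_sets ::
    "'a measure \<Rightarrow> (int \<times> int \<Rightarrow> 'a \<Rightarrow> 'a) \<Rightarrow> real \<Rightarrow> real \<Rightarrow> 'a set set" where
  "directional_kronecker_sets M T \<beta> b = {B \<in> sets M. compactin (L2_topology M)
     (L2_topology M closure_of ((\<lambda>p. koopman T p (indicator B)) ` direction_strip \<beta> b))}"

text \<open>
  As usual in the library, a sub-\<open>\<sigma>\<close>-algebra is represented by a measure carrying it.
  The collection above is already a \<open>\<sigma>\<close>-algebra, so generating adds no sets; see
  \<open>sets_directional_kronecker\<close> below.
\<close>

definition directional_kronecker ::
    "'a measure \<Rightarrow> (int \<times> int \<Rightarrow> 'a \<Rightarrow> 'a) \<Rightarrow> real \<Rightarrow> real \<Rightarrow> 'a measure" where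
  "directional_kronecker M T \<beta> b = sigma (space M) (directional_kronecker_sets M T \<beta> b)"

definition directional_weak_mixing ::
    "'a measure \<Rightarrow> (int \<times> int \<Rightarrow> 'a \<Rightarrow> 'a) \<Rightarrow> real \<Rightarrow> real \<Rightarrow> ('a \<Rightarrow> complex) set" where
  "directional_weak_mixing M T \<beta> b =
     {f \<in> L2 M. AE x in M. complex_cond_exp M (directional_kronecker M T \<beta> b) f x = 0}"


subsection \<open>The directional Kronecker sets form a sigma-algebra\<close>

lemma L2_measurable [measurable_dest]: "f \<in> L2 M \<Longrightarrow> f \<in> borel_measurable M"
  by (simp add: L2_def)

lemma L2_integrable: "f \<in> L2 M \<Longrightarrow> integrable M (\<lambda>x. (cmod (f x))\<^sup>2)"
  by (simp add: L2_def)

lemma L2_diff: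
  assumes f: "f \<in> L2 M" and g: "g \<in> L2 M"
  shows "(\<lambda>x. f x - g x) \<in> L2 M"
proof -
  note [measurable] = L2_measurable[OF f] L2_measurable[OF g]
  have "integrable M (\<lambda>x. (cmod (f x - g x))\<^sup>2)"
  proof (rule Bochner_Integration.integrable_bound)
    show "integrable M (\<lambda>x. 2 * (cmod (f x))\<^sup>2 + 2 * (cmod (g x))\<^sup>2)"
      using L2_integrable[OF f] L2_integrable[OF g] by simp
    have "(cmod (f x - g x))\<^sup>2 \<le> 2 * (cmod (f x))\<^sup>2 + 2 * (cmod (g x))\<^sup>2" for x
    proof -
      have "(cmod (f x - g x))\<^sup>2 \<le> (cmod (f x) + cmod (g x))\<^sup>2"
        by (intro power_mono norm_triangle_ineq4) auto
      also have "\<dots> \<le> 2 * (cmod (f x))\<^sup>2 + 2 * (cmod (g x))\<^sup>2"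
        using sum_squares_bound[of "cmod (f x)" "cmod (g x)"] by (simp add: power2_sum)
      finally show ?thesis .
    qed
    then show "AE x in M. norm ((cmod (f x - g x))\<^sup>2)
        \<le> norm (2 * (cmod (f x))\<^sup>2 + 2 * (cmod (g x))\<^sup>2)"
      by simp
  qed measurable
  then show ?thesis by (simp add: L2_def)
qed

lemma Cauchy_Schwarz_integral:
  fixes u v :: "'a \<Rightarrow> real"
  assumes [measurable]: "u \<in> borel_measurable M" "v \<in> borel_measurable M"
    and u: "integrable M (\<lambda>x. (u x)\<^sup>2)" and v: "integrable M (\<lambda>x. (v x)\<^sup>2)"
    and pos: "\<And>x. 0 \<le> u x" "\<And>x. 0 \<le> v x"
  shows "integrable M (\<lambda>x. u x * v x)"
    and "(LINT x|M. u x * v x) \<le> sqrt (LINT x|M. (u x)\<^sup>2) * sqrt (LINT x|M. (v x)\<^sup>2)"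
proof -
  show I: "integrable M (\<lambda>x. u x * v x)"
  proof (rule Bochner_Integration.integrable_bound)
    show "integrable M (\<lambda>x. (u x)\<^sup>2 + (v x)\<^sup>2)" using u v by simp
    have "u x * v x \<le> (u x)\<^sup>2 + (v x)\<^sup>2" for x
      using sum_squares_bound[of "u x" "v x"] mult_nonneg_nonneg[OF pos, of x x] by linarith
    then show "AE x in M. norm (u x * v x) \<le> norm ((u x)\<^sup>2 + (v x)\<^sup>2)"
      using pos by simp
  qed measurable
  have "(\<integral>\<^sup>+x. ennreal (u x) * ennreal (v x) \<partial>M)\<^sup>2
      \<le> (\<integral>\<^sup>+x. (ennreal (u x))\<^sup>2 \<partial>M) * (\<integral>\<^sup>+x. (ennreal (v x))\<^sup>2 \<partial>M)"
    by (rule Cauchy_Schwarz_nn_integral) auto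
  also have "(\<integral>\<^sup>+x. ennreal (u x) * ennreal (v x) \<partial>M) = ennreal (LINT x|M. u x * v x)"
    using nn_integral_eq_integral[OF I] pos by (simp add: ennreal_mult)
  also have "(\<integral>\<^sup>+x. (ennreal (u x))\<^sup>2 \<partial>M) = ennreal (LINT x|M. (u x)\<^sup>2)"
    using nn_integral_eq_integral[OF u] pos by (simp add: ennreal_power)
  also have "(\<integral>\<^sup>+x. (ennreal (v x))\<^sup>2 \<partial>M) = ennreal (LINT x|M. (v x)\<^sup>2)"
    using nn_integral_eq_integral[OF v] pos by (simp add: ennreal_power)
  finally have "(LINT x|M. u x * v x)\<^sup>2 \<le> (LINT x|M. (u x)\<^sup>2) * (LINT x|M. (v x)\<^sup>2)"
    using pos by (simp add: ennreal_power flip: ennreal_mult)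
  then show "(LINT x|M. u x * v x) \<le> sqrt (LINT x|M. (u x)\<^sup>2) * sqrt (LINT x|M. (v x)\<^sup>2)"
    by (metis real_le_rsqrt real_sqrt_mult)
qed

lemma L2_dist_nonneg: "0 \<le> L2_dist M f g"
  by (simp add: L2_dist_def)

lemma L2_dist_commute: "L2_dist M f g = L2_dist M g f"
  by (simp add: L2_dist_def norm_minus_commute)

lemma L2_dist_cong_AE:
  assumes "f \<in> L2 M" "f' \<in> L2 M" "g \<in> L2 M" "AE x in M. f x = f' x"
  shows "L2_dist M f g = L2_dist M f' g"
proof -
  note [measurable] = assms(1-3)[THEN L2_measurable]
  have "(LINT x|M. (cmod (f x - g x))\<^sup>2) = (LINT x|M. (cmod (f' x - g x))\<^sup>2)"
    using assms(4) by (intro integral_cong_AE) auto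
  then show ?thesis by (simp add: L2_dist_def)
qed

lemma L2_dist_zero_iff:
  assumes "f \<in> L2 M" "g \<in> L2 M"
  shows "L2_dist M f g = 0 \<longleftrightarrow> (AE x in M. f x = g x)"
  using integral_nonneg_eq_0_iff_AE[OF L2_integrable[OF L2_diff[OF assms]]]
  by (simp add: L2_dist_def)

lemma L2_dist_triangle:
  assumes f: "f \<in> L2 M" and g: "g \<in> L2 M" and h: "h \<in> L2 M"
  shows "L2_dist M f h \<le> L2_dist M f g + L2_dist M g h"
proof -
  define u where "u x = cmod (f x - g x)" for x
  define v where "v x = cmod (g x - h x)" for x
  note [measurable] = f[THEN L2_measurable] g[THEN L2_measurable] h[THEN L2_measurable]
  have [measurable]: "u \<in> borel_measurable M" "v \<in> borel_measurable M"
    unfolding u_def[abs_def] v_def[abs_def] by measurable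
  have iu: "integrable M (\<lambda>x. (u x)\<^sup>2)" and iv: "integrable M (\<lambda>x. (v x)\<^sup>2)"
    using L2_integrable[OF L2_diff[OF f g]] L2_integrable[OF L2_diff[OF g h]]
    by (simp_all add: u_def v_def)
  have iuv: "integrable M (\<lambda>x. u x * v x)"
    and cs: "(LINT x|M. u x * v x) \<le> sqrt (LINT x|M. (u x)\<^sup>2) * sqrt (LINT x|M. (v x)\<^sup>2)"
    by (rule Cauchy_Schwarz_integral[OF _ _ iu iv]; simp add: u_def v_def)+
  have "(LINT x|M. (cmod (f x - h x))\<^sup>2) \<le> (LINT x|M. (u x)\<^sup>2 + (v x)\<^sup>2 + 2 * (u x * v x))"
  proof (rule integral_mono)
    show "integrable M (\<lambda>x. (cmod (f x - h x))\<^sup>2)" by (rule L2_integrable[OF L2_diff[OF f h]])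
    show "integrable M (\<lambda>x. (u x)\<^sup>2 + (v x)\<^sup>2 + 2 * (u x * v x))" using iu iv iuv by simp
    show "(cmod (f x - h x))\<^sup>2 \<le> (u x)\<^sup>2 + (v x)\<^sup>2 + 2 * (u x * v x)" for x
    proof -
      have "cmod (f x - h x) \<le> u x + v x"
        unfolding u_def v_def using norm_triangle_ineq[of "f x - g x" "g x - h x"] by simp
      then have "(cmod (f x - h x))\<^sup>2 \<le> (u x + v x)\<^sup>2" by (intro power_mono) auto
      then show ?thesis by (simp add: power2_sum)
    qed
  qed
  also have "\<dots> = (LINT x|M. (u x)\<^sup>2) + (LINT x|M. (v x)\<^sup>2) + 2 * (LINT x|M. u x * v x)"
    using iu iv iuv by simp
  also have "\<dots> \<le> (sqrt (LINT x|M. (u x)\<^sup>2) + sqrt (LINT x|M. (v x)\<^sup>2))\<^sup>2"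
    using cs by (simp add: power2_sum)
  finally have "sqrt (LINT x|M. (cmod (f x - h x))\<^sup>2)
      \<le> sqrt (LINT x|M. (u x)\<^sup>2) + sqrt (LINT x|M. (v x)\<^sup>2)"
    by (intro real_le_lsqrt) auto
  then show ?thesis by (simp add: L2_dist_def u_def v_def)
qed

lemma (in prob_space) L1_le_L2_dist:
  assumes f: "f \<in> L2 M" and g: "g \<in> L2 M"
  shows "integrable M (\<lambda>x. cmod (f x - g x))"
    and "(LINT x|M. cmod (f x - g x)) \<le> L2_dist M f g"
proof -
  note [measurable] = f[THEN L2_measurable] g[THEN L2_measurable]
  have "integrable M (\<lambda>x. cmod (f x - g x) * 1)"
    and "(LINT x|M. cmod (f x - g x) * 1)
      \<le> sqrt (LINT x|M. (cmod (f x - g x))\<^sup>2) * sqrt (LINT x|M. 1\<^sup>2)"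
    by (rule Cauchy_Schwarz_integral; simp add: L2_integrable[OF L2_diff[OF f g]])+
  then show "integrable M (\<lambda>x. cmod (f x - g x))"
    and "(LINT x|M. cmod (f x - g x)) \<le> L2_dist M f g"
    by (simp_all add: L2_dist_def prob_space)
qed

lemma L2_Fatou:
  assumes [simp]: "\<And>j. h j \<in> L2 M" and g: "g \<in> L2 M"
    and [measurable]: "f \<in> borel_measurable M"
    and lim: "AE x in M. (\<lambda>j. h j x) \<longlonglongrightarrow> f x"
    and bound: "\<And>j. j \<ge> k \<Longrightarrow> L2_dist M (h j) g \<le> c"
  shows "f \<in> L2 M" "L2_dist M f g \<le> c"
proof -
  note [measurable] = g[THEN L2_measurable] L2_measurable[of "h _"]
  have c: "0 \<le> c" using bound[of k] L2_dist_nonneg order_trans by blast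
  have "(\<integral>\<^sup>+x. ennreal ((cmod (f x - g x))\<^sup>2) \<partial>M)
      = (\<integral>\<^sup>+x. liminf (\<lambda>j. ennreal ((cmod (h (j + k) x - g x))\<^sup>2)) \<partial>M)"
  proof (rule nn_integral_cong_AE)
    show "AE x in M. ennreal ((cmod (f x - g x))\<^sup>2)
        = liminf (\<lambda>j. ennreal ((cmod (h (j + k) x - g x))\<^sup>2))"
      using lim
    proof eventually_elim
      case (elim x)
      have "(\<lambda>j. ennreal ((cmod (h (j + k) x - g x))\<^sup>2)) \<longlonglongrightarrow> ennreal ((cmod (f x - g x))\<^sup>2)"
        by (intro tendsto_intros LIMSEQ_ignore_initial_segment[OF elim])
      then show ?case by (rule lim_imp_Liminf[symmetric, OF trivial_limit_sequentially])
    qed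
  qed
  also have "\<dots> \<le> liminf (\<lambda>j. \<integral>\<^sup>+x. ennreal ((cmod (h (j + k) x - g x))\<^sup>2) \<partial>M)"
    by (rule nn_integral_liminf) measurable
  also have "\<dots> \<le> ennreal (c\<^sup>2)"
  proof (rule Liminf_le)
    show "\<forall>\<^sub>F j in sequentially.
        (\<integral>\<^sup>+x. ennreal ((cmod (h (j + k) x - g x))\<^sup>2) \<partial>M) \<le> ennreal (c\<^sup>2)"
    proof (rule always_eventually, rule allI)
      fix j
      have "(\<integral>\<^sup>+x. ennreal ((cmod (h (j + k) x - g x))\<^sup>2) \<partial>M)
          = ennreal (LINT x|M. (cmod (h (j + k) x - g x))\<^sup>2)"
        by (rule nn_integral_eq_integral) (auto intro!: L2_integrable L2_diff g)
      also have "\<dots> \<le> ennreal (c\<^sup>2)"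
        using bound[of "j + k"] by (intro ennreal_leI) (simp add: L2_dist_def sqrt_le_D)
      finally show "(\<integral>\<^sup>+x. ennreal ((cmod (h (j + k) x - g x))\<^sup>2) \<partial>M) \<le> ennreal (c\<^sup>2)" .
    qed
  qed simp
  finally have le: "(\<integral>\<^sup>+x. ennreal ((cmod (f x - g x))\<^sup>2) \<partial>M) \<le> ennreal (c\<^sup>2)" .
  have I: "integrable M (\<lambda>x. (cmod (f x - g x))\<^sup>2)"
    by (rule integrableI_bounded) (auto intro: le_less_trans[OF le])
  then have "(\<lambda>x. f x - g x) \<in> L2 M" by (simp add: L2_def)
  moreover have "(\<lambda>x. 0 - g x) \<in> L2 M"
    using g by (simp add: L2_def)
  ultimately have "(\<lambda>x. (f x - g x) - (0 - g x)) \<in> L2 M" by (rule L2_diff)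
  then show "f \<in> L2 M" by simp
  have "ennreal (LINT x|M. (cmod (f x - g x))\<^sup>2) \<le> ennreal (c\<^sup>2)"
    using le nn_integral_eq_integral[OF I] by simp
  then have "(LINT x|M. (cmod (f x - g x))\<^sup>2) \<le> c\<^sup>2" by (simp add: ennreal_le_iff)
  then show "L2_dist M f g \<le> c" using c by (simp add: L2_dist_def real_le_lsqrt)
qed

lemma (in prob_space) L2_complete:
  assumes s: "\<And>n. s n \<in> L2 M"
    and cau: "\<And>e. e > 0 \<Longrightarrow> \<exists>N. \<forall>m\<ge>N. \<forall>n\<ge>N. L2_dist M (s m) (s n) < e"
  obtains f where "f \<in> L2 M" "(\<lambda>n. L2_dist M f (s n)) \<longlonglongrightarrow> 0"
proof -
  have "\<forall>k. \<exists>N. \<forall>m\<ge>N. \<forall>n\<ge>N. L2_dist M (s m) (s n) < (1/2) ^ k"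
    using cau by simp
  then obtain R where R: "\<And>k m n. m \<ge> R k \<Longrightarrow> n \<ge> R k \<Longrightarrow> L2_dist M (s m) (s n) < (1/2) ^ k"
    by metis
  define r where "r k = (\<Sum>i\<le>k. R i)" for k
  have rR: "R k \<le> r k" for k unfolding r_def by (rule member_le_sum) auto
  have rmono: "r j \<le> r k" if "j \<le> k" for j k
    unfolding r_def using that by (intro sum_mono2) auto
  define h where "h k = s (r k)" for k
  have h [simp]: "h k \<in> L2 M" for k by (simp add: h_def s)
  note [measurable] = L2_measurable[OF h]
  define u where "u k x = cmod (h (Suc k) x - h k x)" for k x
  have [measurable]: "u k \<in> borel_measurable M" for k
    unfolding u_def[abs_def] by measurable
  have u: "(\<integral>\<^sup>+x. ennreal (u k x) \<partial>M) \<le> ennreal ((1/2) ^ k)" for k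
  proof -
    have "(\<integral>\<^sup>+x. ennreal (u k x) \<partial>M) = ennreal (LINT x|M. u k x)"
      unfolding u_def by (rule nn_integral_eq_integral) (auto intro!: L1_le_L2_dist)
    also have "\<dots> \<le> ennreal (L2_dist M (h (Suc k)) (h k))"
      unfolding u_def by (intro ennreal_leI L1_le_L2_dist h)
    also have "\<dots> \<le> ennreal ((1/2) ^ k)"
      unfolding h_def using rR[of k] rmono[of k "Suc k"]
      by (intro ennreal_leI order.strict_implies_order[OF R]) auto
    finally show ?thesis .
  qed
  have "(\<integral>\<^sup>+x. (\<Sum>k. ennreal (u k x)) \<partial>M) = (\<Sum>k. \<integral>\<^sup>+x. ennreal (u k x) \<partial>M)"
    by (rule nn_integral_suminf) measurable
  also have "\<dots> \<le> (\<Sum>k. ennreal ((1/2) ^ k))" by (intro suminf_le u) auto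
  also have "\<dots> = ennreal (\<Sum>k. (1/2) ^ k)"
    by (rule suminf_ennreal2) (auto intro: summable_geometric)
  also have "\<dots> < \<infinity>" by simp
  finally have "AE x in M. (\<Sum>k. ennreal (u k x)) \<noteq> \<infinity>"
    by (intro nn_integral_PInf_AE) auto
  then have conv: "AE x in M. convergent (\<lambda>k. h k x)"
  proof eventually_elim
    case (elim x)
    have "summable (\<lambda>k. u k x)"
      using elim by (intro summable_suminf_not_top) (auto simp: u_def)
    then have "summable (\<lambda>k. h (Suc k) x - h k x)"
      by (intro summable_norm_cancel[of "\<lambda>k. h (Suc k) x - h k x"]) (simp add: u_def)
    then have "convergent (\<lambda>k. h k x - h 0 x)"
      by (simp add: summable_iff_convergent sum_lessThan_telescope[of "\<lambda>k. h k x"])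
    then show ?case by (simp add: convergent_diff_const_right_iff)
  qed
  define f where "f x = lim (\<lambda>k. h k x)" for x
  have f [measurable]: "f \<in> borel_measurable M"
    unfolding f_def[abs_def] by (rule borel_measurable_lim_metric) measurable
  have lim: "AE x in M. (\<lambda>k. h k x) \<longlonglongrightarrow> f x"
    using conv by eventually_elim (simp add: f_def convergent_LIMSEQ_iff)
  have bound: "L2_dist M (h j) (s n) \<le> (1/2) ^ k" if "j \<ge> k" "n \<ge> R k" for j k n
    unfolding h_def using that rR[of k] rmono[of k j] by (intro order.strict_implies_order[OF R]) auto
  have fL2: "f \<in> L2 M"
    by (rule L2_Fatou(1)[OF h s f lim bound[of 0 _ "R 0"]]) auto
  have fs: "L2_dist M f (s n) \<le> (1/2) ^ k" if "n \<ge> R k" for n k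
    by (rule L2_Fatou(2)[OF h s f lim bound[of k]]) (use that in auto)
  have "(\<lambda>n. L2_dist M f (s n)) \<longlonglongrightarrow> 0"
  proof (rule LIMSEQ_I)
    fix e :: real assume "e > 0"
    then obtain k where k: "(1/2) ^ k < e" using real_arch_pow_inv[of e "1/2"] by auto
    have "norm (L2_dist M f (s n) - 0) < e" if "n \<ge> R k" for n
      using fs[OF that] k L2_dist_nonneg[of M f "s n"] by simp
    then show "\<exists>N. \<forall>n\<ge>N. norm (L2_dist M f (s n) - 0) < e" by blast
  qed
  with fL2 show ?thesis by (rule that)
qed

lemma openin_L2_topology:
  "openin (L2_topology M) U \<longleftrightarrow>
     U \<subseteq> L2 M \<and> (\<forall>f\<in>U. \<exists>e>0. \<forall>g\<in>L2 M. L2_dist M f g < e \<longrightarrow> g \<in> U)"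
proof -
  have "istopology (\<lambda>U. U \<subseteq> L2 M \<and> (\<forall>f\<in>U. \<exists>e>0. \<forall>g\<in>L2 M. L2_dist M f g < e \<longrightarrow> g \<in> U))"
    unfolding istopology_def
  proof (rule conjI; intro allI impI conjI ballI)
    fix U V f
    assume U: "U \<subseteq> L2 M \<and> (\<forall>f\<in>U. \<exists>e>0. \<forall>g\<in>L2 M. L2_dist M f g < e \<longrightarrow> g \<in> U)"
      and V: "V \<subseteq> L2 M \<and> (\<forall>f\<in>V. \<exists>e>0. \<forall>g\<in>L2 M. L2_dist M f g < e \<longrightarrow> g \<in> V)"
    show "U \<inter> V \<subseteq> L2 M" using U by blast
    assume "f \<in> U \<inter> V"
    with U V obtain d e where "d > 0" "e > 0"
      "\<forall>g\<in>L2 M. L2_dist M f g < d \<longrightarrow> g \<in> U" "\<forall>g\<in>L2 M. L2_dist M f g < e \<longrightarrow> g \<in> V"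
      by (metis IntD1 IntD2)
    then show "\<exists>e>0. \<forall>g\<in>L2 M. L2_dist M f g < e \<longrightarrow> g \<in> U \<inter> V"
      by (intro exI[of _ "min d e"]) auto
  next
    fix \<U> :: "('a \<Rightarrow> complex) set set" and f
    assume \<U>: "\<forall>U\<in>\<U>. U \<subseteq> L2 M \<and> (\<forall>f\<in>U. \<exists>e>0. \<forall>g\<in>L2 M. L2_dist M f g < e \<longrightarrow> g \<in> U)"
    show "\<Union>\<U> \<subseteq> L2 M" using \<U> by blast
    assume "f \<in> \<Union>\<U>"
    with \<U> show "\<exists>e>0. \<forall>g\<in>L2 M. L2_dist M f g < e \<longrightarrow> g \<in> \<Union>\<U>"
      by (meson UnionE UnionI)
  qed
  then show ?thesis by (simp add: L2_topology_def topology_inverse')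
qed

lemma topspace_L2_topology [simp]: "topspace (L2_topology M) = L2 M"
proof -
  have "openin (L2_topology M) (L2 M)"
    by (auto simp: openin_L2_topology intro: exI[of _ 1])
  then show ?thesis
    by (metis openin_L2_topology openin_subset openin_topspace subset_antisym)
qed

lemma openin_L2_ball:
  assumes f: "f \<in> L2 M"
  shows "openin (L2_topology M) {g \<in> L2 M. L2_dist M f g < e}"
  unfolding openin_L2_topology
proof (intro conjI ballI)
  fix g assume g: "g \<in> {g \<in> L2 M. L2_dist M f g < e}"
  show "\<exists>d>0. \<forall>h\<in>L2 M. L2_dist M g h < d \<longrightarrow> h \<in> {g \<in> L2 M. L2_dist M f g < e}"
  proof (intro exI[of _ "e - L2_dist M f g"] conjI ballI impI)
    fix h assume "h \<in> L2 M" "L2_dist M g h < e - L2_dist M f g"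
    then show "h \<in> {g \<in> L2 M. L2_dist M f g < e}"
      using L2_dist_triangle[OF f, of g h] g by simp
  qed (use g in simp)
qed auto

text \<open>
  Compactness is transferred from the metric space obtained by choosing one representative
  in each class of functions that agree almost everywhere.
\<close>

lemma (in prob_space) compactin_L2_closure_iff:
  assumes S: "S \<subseteq> L2 M"
  shows "compactin (L2_topology M) (L2_topology M closure_of S) \<longleftrightarrow>
    (\<forall>e>0. \<exists>K. finite K \<and> K \<subseteq> L2 M \<and> (\<forall>f\<in>S. \<exists>g\<in>K. L2_dist M g f < e))"
proof
  assume C: "compactin (L2_topology M) (L2_topology M closure_of S)"
  show "\<forall>e>0. \<exists>K. finite K \<and> K \<subseteq> L2 M \<and> (\<forall>f\<in>S. \<exists>g\<in>K. L2_dist M g f < e)"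
  proof (intro allI impI)
    fix e :: real assume "e > 0"
    define \<U> where "\<U> = (\<lambda>f. {g \<in> L2 M. L2_dist M f g < e}) ` L2 M"
    have self: "L2_dist M f f = 0" if "f \<in> L2 M" for f by (simp add: L2_dist_def)
    have "L2_topology M closure_of S \<subseteq> \<Union>\<U>"
      using closure_of_subset_topspace[of "L2_topology M" S] self \<open>e > 0\<close>
      by (force simp: \<U>_def)
    moreover have "\<And>U. U \<in> \<U> \<Longrightarrow> openin (L2_topology M) U"
      by (auto simp: \<U>_def openin_L2_ball)
    ultimately obtain \<F> where \<F>: "finite \<F>" "\<F> \<subseteq> \<U>" "L2_topology M closure_of S \<subseteq> \<Union>\<F>"
      using C unfolding compactin_def by (metis subsetI)
    then obtain K where K: "finite K" "K \<subseteq> L2 M" "\<F> = (\<lambda>f. {g \<in> L2 M. L2_dist M f g < e}) ` K"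
      unfolding \<U>_def by (meson finite_subset_image)
    have "S \<subseteq> \<Union>\<F>" using \<F>(3) S closure_of_subset[of S "L2_topology M"] by simp
    with K show "\<exists>K. finite K \<and> K \<subseteq> L2 M \<and> (\<forall>f\<in>S. \<exists>g\<in>K. L2_dist M g f < e)"
      by (intro exI[of _ K]) auto
  qed
next
  assume tb: "\<forall>e>0. \<exists>K. finite K \<and> K \<subseteq> L2 M \<and> (\<forall>f\<in>S. \<exists>g\<in>K. L2_dist M g f < e)"
  define r where "r f = (SOME g. g \<in> L2 M \<and> (AE x in M. g x = f x))" for f
  have r: "r f \<in> L2 M" "AE x in M. r f x = f x" if "f \<in> L2 M" for f
    using someI[of "\<lambda>g. g \<in> L2 M \<and> (AE x in M. g x = f x)" f] that by (auto simp: r_def)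
  have r_eq: "r f = r g" if "AE x in M. f x = g x" for f g
  proof -
    have "(AE x in M. h x = f x) \<longleftrightarrow> (AE x in M. h x = g x)" for h
    proof
      show "AE x in M. h x = g x" if "AE x in M. h x = f x"
        using that \<open>AE x in M. f x = g x\<close> by eventually_elim simp
      show "AE x in M. h x = f x" if "AE x in M. h x = g x"
        using that \<open>AE x in M. f x = g x\<close> by eventually_elim simp
    qed
    then show ?thesis by (simp add: r_def)
  qed
  define Q where "Q = r ` L2 M"
  have QL2: "Q \<subseteq> L2 M" using r by (auto simp: Q_def)
  have rQ: "r f \<in> Q" if "f \<in> L2 M" for f using that by (simp add: Q_def)
  have rr: "r q = q" if "q \<in> Q" for q using that r r_eq by (auto simp: Q_def)
  have dist_r: "L2_dist M (r f) g = L2_dist M f g" "L2_dist M g (r f) = L2_dist M g f"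
    if "f \<in> L2 M" "g \<in> L2 M" for f g
    using L2_dist_cong_AE[OF r(1) _ _ r(2), of f g] that by (auto simp: L2_dist_commute)
  interpret Q: Metric_space Q "L2_dist M"
  proof
    fix f g h assume "f \<in> Q" "g \<in> Q" "h \<in> Q"
    then show "L2_dist M f h \<le> L2_dist M f g + L2_dist M g h"
      using QL2 by (intro L2_dist_triangle) auto
  next
    fix f g assume "f \<in> Q" "g \<in> Q"
    then have "L2_dist M f g = 0 \<longleftrightarrow> (AE x in M. f x = g x)"
      using QL2 by (intro L2_dist_zero_iff) auto
    then show "L2_dist M f g = 0 \<longleftrightarrow> f = g"
      using \<open>f \<in> Q\<close> \<open>g \<in> Q\<close> rr r_eq by (metis (mono_tags, lifting) AE_I2)
  qed (auto simp: L2_dist_nonneg L2_dist_commute)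
  have complete: "Q.mcomplete"
    unfolding Q.mcomplete_def
  proof (intro allI impI)
    fix \<sigma> assume \<sigma>: "Q.MCauchy \<sigma>"
    then have \<sigma>Q: "\<sigma> n \<in> Q" for n by (auto simp: Q.MCauchy_def)
    obtain f where f: "f \<in> L2 M" "(\<lambda>n. L2_dist M f (\<sigma> n)) \<longlonglongrightarrow> 0"
    proof (rule L2_complete)
      show "\<sigma> n \<in> L2 M" for n using \<sigma>Q QL2 by blast
      show "\<exists>N. \<forall>m\<ge>N. \<forall>n\<ge>N. L2_dist M (\<sigma> m) (\<sigma> n) < e" if "e > 0" for e
        using \<sigma> that unfolding Q.MCauchy_def by meson
    qed
    have "limitin Q.mtopology \<sigma> (r f) sequentially"
      unfolding Q.limitin_metric
    proof (intro conjI allI impI)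
      show "r f \<in> Q" using f by (simp add: Q_def)
      fix e :: real assume "e > 0"
      then have "\<forall>\<^sub>F n in sequentially. L2_dist M f (\<sigma> n) < e"
        using f(2) by (rule order_tendstoD(2)[rotated])
      then show "\<forall>\<^sub>F n in sequentially. \<sigma> n \<in> Q \<and> L2_dist M (\<sigma> n) (r f) < e"
      proof eventually_elim
        case (elim n)
        then show ?case
          using \<sigma>Q[of n] QL2 dist_r(2)[OF f(1), of "\<sigma> n"] by (auto simp: L2_dist_commute)
      qed
    qed
    then show "\<exists>f. limitin Q.mtopology \<sigma> f sequentially" by blast
  qed
  have "Q.mtotally_bounded (r ` S)"
    unfolding Q.mtotally_bounded_def
  proof (intro allI impI)
    fix e :: real assume "e > 0"
    with tb obtain K where K: "finite K" "K \<subseteq> L2 M" "\<forall>f\<in>S. \<exists>g\<in>K. L2_dist M g f < e/2"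
      by (meson half_gt_zero)
    define K' where "K' = {g \<in> K. \<exists>f\<in>S. L2_dist M g f < e/2}"
    have "\<forall>g\<in>K'. \<exists>f. f \<in> S \<and> L2_dist M g f < e/2" by (auto simp: K'_def)
    then obtain c where c: "\<And>g. g \<in> K' \<Longrightarrow> c g \<in> S \<and> L2_dist M g (c g) < e/2" by metis
    show "\<exists>K. finite K \<and> K \<subseteq> r ` S \<and> r ` S \<subseteq> (\<Union>x\<in>K. Q.mball x e)"
    proof (intro exI[of _ "r ` c ` K'"] conjI)
      show "finite (r ` c ` K')" using K by (simp add: K'_def)
      show "r ` c ` K' \<subseteq> r ` S" using c by auto
      show "r ` S \<subseteq> (\<Union>x\<in>r ` c ` K'. Q.mball x e)"
      proof
        fix q assume "q \<in> r ` S"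
        then obtain f where f: "f \<in> S" "q = r f" by auto
        with K obtain g where g: "g \<in> K" "L2_dist M g f < e/2" by auto
        then have "g \<in> K'" using f by (auto simp: K'_def)
        note cg = c[OF this]
        have L: "g \<in> L2 M" "f \<in> L2 M" "c g \<in> L2 M" using S K g f cg by auto
        have "L2_dist M (c g) f < e"
          using L2_dist_triangle[OF L(3,1,2)] g cg by (simp add: L2_dist_commute)
        then have "r f \<in> Q.mball (r (c g)) e"
          using L rQ r(1) by (simp add: Q.in_mball dist_r)
        with f \<open>g \<in> K'\<close> show "q \<in> (\<Union>x\<in>r ` c ` K'. Q.mball x e)" by auto
      qed
    qed
  qed
  then have C: "compactin Q.mtopology (Q.mtopology closure_of (r ` S))"
    using Q.mtotally_bounded_eq_compact_closure_of[OF complete] by blast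
  have sat: "r f \<in> U \<longleftrightarrow> f \<in> U" if "openin (L2_topology M) U" "f \<in> L2 M" for U f
  proof -
    have "L2_dist M f (r f) = 0" "L2_dist M (r f) f = 0"
      using that(2) r[of f] L2_dist_zero_iff[of "r f" M f] by (auto simp: L2_dist_commute)
    then show ?thesis
      using that r[of f] unfolding openin_L2_topology by metis
  qed
  have op: "openin Q.mtopology (U \<inter> Q)" if U: "openin (L2_topology M) U" for U
    unfolding Q.openin_mtopology
  proof (intro conjI allI impI)
    fix f assume "f \<in> U \<inter> Q"
    then obtain e where e: "e > 0" "\<And>g. g \<in> L2 M \<Longrightarrow> L2_dist M f g < e \<Longrightarrow> g \<in> U"
      using U unfolding openin_L2_topology by (metis IntD1)
    have "Q.mball f e \<subseteq> U \<inter> Q"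
    proof
      fix g assume "g \<in> Q.mball f e"
      then have "g \<in> Q" "L2_dist M f g < e" by (simp_all only: Q.in_mball)
      then show "g \<in> U \<inter> Q" using QL2 e(2)[of g] by blast
    qed
    with e(1) show "\<exists>e>0. Q.mball f e \<subseteq> U \<inter> Q" by blast
  qed blast
  have clos: "r f \<in> Q.mtopology closure_of (r ` S)" if fS: "f \<in> L2_topology M closure_of S" for f
    unfolding Q.metric_closure_of
  proof (intro CollectI conjI allI impI)
    have f: "f \<in> L2 M" using fS by (simp add: in_closure_of)
    then show "r f \<in> Q" by (simp add: Q_def)
    fix e :: real assume "e > 0"
    define V where "V = {g \<in> L2 M. L2_dist M f g < e}"
    have "f \<in> V" using f \<open>e > 0\<close> by (simp add: V_def L2_dist_def)
    moreover have "openin (L2_topology M) V" unfolding V_def by (rule openin_L2_ball[OF f])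
    ultimately obtain g where "g \<in> S" "g \<in> V" using fS by (meson in_closure_of)
    then have g: "g \<in> S" "g \<in> L2 M" "L2_dist M f g < e" by (simp_all add: V_def)
    have "r g \<in> Q.mball (r f) e"
      using g f rQ[OF f] rQ[OF g(2)] r(1)[OF g(2)] by (simp add: Q.in_mball dist_r)
    with g(1) show "\<exists>y\<in>r ` S. y \<in> Q.mball (r f) e"
      by blast
  qed
  show "compactin (L2_topology M) (L2_topology M closure_of S)"
    unfolding compactin_def
  proof (intro conjI allI impI)
    show "L2_topology M closure_of S \<subseteq> topspace (L2_topology M)"
      by (rule closure_of_subset_topspace)
    fix \<U> assume \<U>: "Ball \<U> (openin (L2_topology M)) \<and> L2_topology M closure_of S \<subseteq> \<Union>\<U>"
    have "Q.mtopology closure_of (r ` S) \<subseteq> \<Union>((\<lambda>U. U \<inter> Q) ` \<U>)"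
    proof
      fix q assume q: "q \<in> Q.mtopology closure_of (r ` S)"
      then have qQ: "q \<in> Q" by (simp add: Q.metric_closure_of)
      have "q \<in> L2_topology M closure_of S"
        unfolding in_closure_of
      proof (intro conjI allI impI)
        show "q \<in> topspace (L2_topology M)" using qQ QL2 by auto
        fix U assume U: "q \<in> U \<and> openin (L2_topology M) U"
        with q qQ op[of U] obtain f where "f \<in> S" "r f \<in> U"
          unfolding in_closure_of by blast
        then show "\<exists>f. f \<in> S \<and> f \<in> U" using sat[of U f] U S by blast
      qed
      with \<U> qQ show "q \<in> \<Union>((\<lambda>U. U \<inter> Q) ` \<U>)" by auto
    qed
    moreover have "\<forall>V\<in>(\<lambda>U. U \<inter> Q) ` \<U>. openin Q.mtopology V" using \<U> op by auto
    ultimately obtain \<F> where "finite \<F>" "\<F> \<subseteq> (\<lambda>U. U \<inter> Q) ` \<U>"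
      "Q.mtopology closure_of (r ` S) \<subseteq> \<Union>\<F>"
      using C unfolding compactin_def by meson
    then obtain \<G> where \<G>: "finite \<G>" "\<G> \<subseteq> \<U>"
      "Q.mtopology closure_of (r ` S) \<subseteq> \<Union>((\<lambda>U. U \<inter> Q) ` \<G>)"
      by (metis finite_subset_image)
    have "L2_topology M closure_of S \<subseteq> \<Union>\<G>"
    proof
      fix f assume f: "f \<in> L2_topology M closure_of S"
      then obtain U where U: "U \<in> \<G>" "r f \<in> U" using clos \<G>(3) by blast
      moreover have "f \<in> L2 M" using f by (simp add: in_closure_of)
      ultimately have "f \<in> U" using sat[of U f] \<G>(2) \<U> by blast
      with U show "f \<in> \<Union>\<G>" by blast
    qed
    with \<G> show "\<exists>\<F>. finite \<F> \<and> \<F> \<subseteq> \<U> \<and> L2_topology M closure_of S \<subseteq> \<Union>\<F>" by blast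
  qed
qed

context Z2_mps
begin

lemma T_measurable [measurable]: "T p \<in> measurable M M"
proof -
  have "continuous_on UNIV (T p)"
    using T_homeomorphism[of p] by (auto simp: homeomorphism_def)
  then have "T p \<in> borel_measurable borel" by (rule borel_measurable_continuous_onI)
  then show ?thesis by (simp add: measurable_cong_sets[OF sets_eq_borel sets_eq_borel])
qed

lemma koopman_indicator_L2:
  assumes [measurable]: "B \<in> sets M"
  shows "koopman T p (indicator B) \<in> L2 M"
proof -
  have [measurable]: "koopman T p (indicator B) \<in> borel_measurable M"
    unfolding koopman_def comp_def by measurable
  have "integrable M (\<lambda>x. (cmod (koopman T p (indicator B) x))\<^sup>2)"
    by (rule integrable_const_bound[of _ 1]) (auto simp: koopman_def indicator_def)
  then show ?thesis by (simp add: L2_def)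
qed

lemma kronecker_iff_partition:
  assumes B: "B \<in> sets M"
  shows "B \<in> directional_kronecker_sets M T \<beta> b \<longleftrightarrow>
    (\<forall>e>0. \<exists>c :: int \<times> int \<Rightarrow> nat. finite (c ` direction_strip \<beta> b) \<and>
      (\<forall>p\<in>direction_strip \<beta> b. \<forall>q\<in>direction_strip \<beta> b. c p = c q \<longrightarrow>
        L2_dist M (koopman T p (indicator B)) (koopman T q (indicator B)) < e))"
    (is "_ \<longleftrightarrow> ?P")
proof -
  let ?f = "\<lambda>p. koopman T p (indicator B)" and ?L = "direction_strip \<beta> b"
  have "B \<in> directional_kronecker_sets M T \<beta> b \<longleftrightarrow>
    (\<forall>e>0. \<exists>K. finite K \<and> K \<subseteq> L2 M \<and> (\<forall>f\<in>?f ` ?L. \<exists>g\<in>K. L2_dist M g f < e))"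
    unfolding directional_kronecker_sets_def using B koopman_indicator_L2[OF B]
    by (subst compactin_L2_closure_iff[symmetric]) auto
  also have "\<dots> \<longleftrightarrow> ?P"
  proof (intro iffI allI impI)
    fix e :: real
    assume "\<forall>e>0. \<exists>K. finite K \<and> K \<subseteq> L2 M \<and> (\<forall>f\<in>?f ` ?L. \<exists>g\<in>K. L2_dist M g f < e)" "e > 0"
    then obtain K where K: "finite K" "K \<subseteq> L2 M" "\<forall>f\<in>?f ` ?L. \<exists>g\<in>K. L2_dist M g f < e/2"
      by (meson half_gt_zero)
    then have "\<forall>p\<in>?L. \<exists>g. g \<in> K \<and> L2_dist M g (?f p) < e/2" by auto
    then obtain c where c: "\<And>p. p \<in> ?L \<Longrightarrow> c p \<in> K \<and> L2_dist M (c p) (?f p) < e/2" by metis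
    obtain i :: "('a \<Rightarrow> complex) \<Rightarrow> nat" where i: "inj_on i K"
      using finite_imp_inj_to_nat_seg[OF K(1)] by blast
    show "\<exists>c :: int \<times> int \<Rightarrow> nat. finite (c ` ?L) \<and>
        (\<forall>p\<in>?L. \<forall>q\<in>?L. c p = c q \<longrightarrow> L2_dist M (?f p) (?f q) < e)"
    proof (intro exI[of _ "\<lambda>p. i (c p)"] conjI ballI impI)
      show "finite ((\<lambda>p. i (c p)) ` ?L)"
        by (rule finite_subset[OF _ finite_imageI[OF K(1), of i]]) (use c in auto)
      fix p q assume "p \<in> ?L" "q \<in> ?L" "i (c p) = i (c q)"
      then have pq: "p \<in> ?L" "q \<in> ?L" "c p = c q"
        using c[of p] c[of q] inj_onD[OF i, of "c p" "c q"] by simp_all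
      have "c p \<in> L2 M" using c[OF pq(1)] K(2) by blast
      then show "L2_dist M (?f p) (?f q) < e"
        using L2_dist_triangle[OF koopman_indicator_L2[OF B] _ koopman_indicator_L2[OF B], of "c p" p q]
          c[OF pq(1)] c[OF pq(2)] pq(3) by (simp add: L2_dist_commute)
    qed
  next
    fix e :: real
    assume ?P "e > 0"
    then obtain c :: "int \<times> int \<Rightarrow> nat" where c: "finite (c ` ?L)"
      "\<And>p q. p \<in> ?L \<Longrightarrow> q \<in> ?L \<Longrightarrow> c p = c q \<Longrightarrow> L2_dist M (?f p) (?f q) < e"
      by blast
    show "\<exists>K. finite K \<and> K \<subseteq> L2 M \<and> (\<forall>f\<in>?f ` ?L. \<exists>g\<in>K. L2_dist M g f < e)"
    proof (intro exI[of _ "(\<lambda>y. ?f (inv_into ?L c y)) ` c ` ?L"] conjI ballI)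
      fix f assume "f \<in> ?f ` ?L"
      then obtain p where p: "p \<in> ?L" "f = ?f p" by auto
      then have "L2_dist M (?f (inv_into ?L c (c p))) (?f p) < e"
        by (intro c(2)) (auto simp: inv_into_into f_inv_into_f)
      with p show "\<exists>g\<in>(\<lambda>y. ?f (inv_into ?L c y)) ` c ` ?L. L2_dist M g f < e" by auto
    qed (use c(1) in \<open>auto intro: koopman_indicator_L2[OF B]\<close>)
  qed
  finally show ?thesis .
qed

lemma L2_dist_koopman_indicator:
  assumes [measurable]: "A \<in> sets M" "B \<in> sets M"
  shows "L2_dist M (koopman T p (indicator A)) (koopman T p (indicator B)) =
    sqrt (prob ((A - B) \<union> (B - A)))"
proof -
  let ?D = "(A - B) \<union> (B - A)"
  have "(LINT x|M. (cmod (koopman T p (indicator A) x - koopman T p (indicator B) x))\<^sup>2)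
      = (LINT x|M. indicator ?D (T p x))"
    by (intro Bochner_Integration.integral_cong) (auto simp: koopman_def indicator_def)
  also have "\<dots> = (LINT x|distr M M (T p). indicator ?D x)"
    by (rule integral_distr[symmetric]) measurable
  also have "\<dots> = prob ?D" by (simp add: T_invariant)
  finally show ?thesis by (simp add: L2_dist_def)
qed

lemma kronecker_Compl:
  assumes B: "B \<in> directional_kronecker_sets M T \<beta> b"
  shows "space M - B \<in> directional_kronecker_sets M T \<beta> b"
proof -
  have BM [measurable]: "B \<in> sets M" using B by (simp add: directional_kronecker_sets_def)
  have "L2_dist M (koopman T p (indicator (space M - B))) (koopman T q (indicator (space M - B)))
      = L2_dist M (koopman T p (indicator B)) (koopman T q (indicator B))" for p q
    unfolding L2_dist_def
    by (intro arg_cong[where f = sqrt] Bochner_Integration.integral_cong)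
      (auto simp: koopman_def indicator_def measurable_space[OF T_measurable])
  with B BM show ?thesis by (simp add: kronecker_iff_partition)
qed

lemma kronecker_Un:
  assumes A: "A \<in> directional_kronecker_sets M T \<beta> b"
    and B: "B \<in> directional_kronecker_sets M T \<beta> b"
  shows "A \<union> B \<in> directional_kronecker_sets M T \<beta> b"
proof -
  let ?L = "direction_strip \<beta> b"
  have AM: "A \<in> sets M" and BM: "B \<in> sets M" and UM: "A \<union> B \<in> sets M"
    using A B by (auto simp: directional_kronecker_sets_def)
  let ?d = "\<lambda>B p q. L2_dist M (koopman T p (indicator B)) (koopman T q (indicator B))"
  have le: "?d (A \<union> B) p q \<le> ?d A p q + ?d B p q" for p q
  proof -
    let ?u = "\<lambda>x. cmod (koopman T p (indicator A) x - koopman T q (indicator A) x)"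
    let ?v = "\<lambda>x. cmod (koopman T p (indicator B) x - koopman T q (indicator B) x)"
    let ?w = "\<lambda>x. cmod (koopman T p (indicator (A \<union> B)) x - koopman T q (indicator (A \<union> B)) x)"
    have I: "integrable M (\<lambda>x. (?u x)\<^sup>2)" "integrable M (\<lambda>x. (?v x)\<^sup>2)"
        "integrable M (\<lambda>x. (?w x)\<^sup>2)"
      by (rule L2_integrable[OF L2_diff] koopman_indicator_L2 AM BM UM)+
    have "(LINT x|M. (?w x)\<^sup>2) \<le> (LINT x|M. (?u x)\<^sup>2 + (?v x)\<^sup>2)"
      using I by (intro integral_mono) (auto simp: koopman_def indicator_def)
    also have "\<dots> = (LINT x|M. (?u x)\<^sup>2) + (LINT x|M. (?v x)\<^sup>2)" using I by simp
    finally have "sqrt (LINT x|M. (?w x)\<^sup>2) \<le> sqrt ((LINT x|M. (?u x)\<^sup>2) + (LINT x|M. (?v x)\<^sup>2))"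
      by simp
    also have "\<dots> \<le> sqrt (LINT x|M. (?u x)\<^sup>2) + sqrt (LINT x|M. (?v x)\<^sup>2)"
      by (rule sqrt_add_le_add_sqrt) auto
    finally show ?thesis by (simp add: L2_dist_def)
  qed
  show ?thesis
    unfolding kronecker_iff_partition[OF UM]
  proof (intro allI impI)
    fix e :: real assume "e > 0"
    then have e2: "e/2 > 0" by simp
    obtain c :: "int \<times> int \<Rightarrow> nat" where
      c: "finite (c ` ?L)" "\<And>p q. p \<in> ?L \<Longrightarrow> q \<in> ?L \<Longrightarrow> c p = c q \<Longrightarrow> ?d A p q < e/2"
      using A[unfolded kronecker_iff_partition[OF AM], rule_format, OF e2] by blast
    obtain c' :: "int \<times> int \<Rightarrow> nat" where
      c': "finite (c' ` ?L)" "\<And>p q. p \<in> ?L \<Longrightarrow> q \<in> ?L \<Longrightarrow> c' p = c' q \<Longrightarrow> ?d B p q < e/2"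
      using B[unfolded kronecker_iff_partition[OF BM], rule_format, OF e2] by blast
    have "finite ((\<lambda>p. prod_encode (c p, c' p)) ` ?L)"
      by (rule finite_subset[OF _ finite_imageI[OF finite_cartesian_product[OF c(1) c'(1)],
              of prod_encode]]) auto
    moreover have "?d (A \<union> B) p q < e"
      if "p \<in> ?L" "q \<in> ?L" "prod_encode (c p, c' p) = prod_encode (c q, c' q)" for p q
      using le[of p q] c(2)[of p q] c'(2)[of p q] that by simp
    ultimately show "\<exists>c :: int \<times> int \<Rightarrow> nat. finite (c ` ?L) \<and>
        (\<forall>p\<in>?L. \<forall>q\<in>?L. c p = c q \<longrightarrow> ?d (A \<union> B) p q < e)"
      by (intro exI[of _ "\<lambda>p. prod_encode (c p, c' p)"]) blast
  qed
qed

lemma kronecker_UN: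
  fixes B :: "nat \<Rightarrow> 'a set"
  assumes B: "range B \<subseteq> directional_kronecker_sets M T \<beta> b"
  shows "(\<Union>i. B i) \<in> directional_kronecker_sets M T \<beta> b"
proof -
  let ?L = "direction_strip \<beta> b" and ?U = "\<Union>i. B i"
  let ?f = "\<lambda>B p. koopman T p (indicator B)"
  have BM [measurable]: "B i \<in> sets M" for i
    using B by (auto simp: directional_kronecker_sets_def)
  have UM: "?U \<in> sets M" by measurable
  define C where "C n = (\<Union>i\<le>n. B i)" for n
  have CM [measurable]: "C n \<in> sets M" for n unfolding C_def by measurable
  have C: "C n \<in> directional_kronecker_sets M T \<beta> b" for n
  proof (induction n)
    case (Suc n)
    have "C (Suc n) = C n \<union> B (Suc n)" by (auto simp: C_def atMost_Suc)
    with Suc B show ?case by (auto intro: kronecker_Un)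
  qed (use B in \<open>auto simp: C_def\<close>)
  have "(\<lambda>n. prob (?U - C n)) \<longlonglongrightarrow> prob (\<Inter>n. ?U - C n)"
    by (rule finite_Lim_measure_decseq) (auto simp: decseq_def C_def intro: order_trans)
  also have "(\<Inter>n. ?U - C n) = {}" by (auto simp: C_def)
  finally have lim: "(\<lambda>n. prob (?U - C n)) \<longlonglongrightarrow> 0" by simp
  show ?thesis
    unfolding kronecker_iff_partition[OF UM]
  proof (intro allI impI)
    fix e :: real assume e: "e > 0"
    then have "\<forall>\<^sub>F n in sequentially. prob (?U - C n) < (e/3)\<^sup>2"
      by (intro order_tendstoD[OF lim]) simp
    then obtain n where n: "prob (?U - C n) < (e/3)\<^sup>2" by (auto dest: eventually_happens)
    have "(?U - C n) \<union> (C n - ?U) = ?U - C n" by (auto simp: C_def)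
    then have near: "L2_dist M (?f ?U p) (?f (C n) p) < e/3" for p
      using real_less_lsqrt[OF _ n] e by (simp add: L2_dist_koopman_indicator[OF UM CM])
    have "e/3 > 0" using e by simp
    then obtain c :: "int \<times> int \<Rightarrow> nat" where c: "finite (c ` ?L)"
      "\<And>p q. p \<in> ?L \<Longrightarrow> q \<in> ?L \<Longrightarrow> c p = c q \<Longrightarrow> L2_dist M (?f (C n) p) (?f (C n) q) < e/3"
      using C[of n, unfolded kronecker_iff_partition[OF CM], rule_format, OF \<open>e/3 > 0\<close>] by blast
    show "\<exists>c :: int \<times> int \<Rightarrow> nat. finite (c ` ?L) \<and>
        (\<forall>p\<in>?L. \<forall>q\<in>?L. c p = c q \<longrightarrow> L2_dist M (?f ?U p) (?f ?U q) < e)"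
    proof (intro exI[of _ c] conjI ballI impI c(1))
      fix p q assume "p \<in> ?L" "q \<in> ?L" "c p = c q"
      note pq = c(2)[OF this]
      note f = koopman_indicator_L2[OF UM] koopman_indicator_L2[OF CM]
      have "L2_dist M (?f ?U p) (?f ?U q)
          \<le> L2_dist M (?f ?U p) (?f (C n) p) + L2_dist M (?f (C n) p) (?f ?U q)"
        by (rule L2_dist_triangle f)+
      also have "L2_dist M (?f (C n) p) (?f ?U q)
          \<le> L2_dist M (?f (C n) p) (?f (C n) q) + L2_dist M (?f (C n) q) (?f ?U q)"
        by (rule L2_dist_triangle f)+
      finally show "L2_dist M (?f ?U p) (?f ?U q) < e"
        using near[of p] near[of q] pq by (simp add: L2_dist_commute)
    qed
  qed
qed

lemma sigma_algebra_kronecker: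
  "sigma_algebra (space M) (directional_kronecker_sets M T \<beta> b)"
  unfolding sigma_algebra_iff2
proof (intro conjI ballI allI impI)
  show "directional_kronecker_sets M T \<beta> b \<subseteq> Pow (space M)"
    using sets.space_closed by (auto simp: directional_kronecker_sets_def)
  show "{} \<in> directional_kronecker_sets M T \<beta> b"
    unfolding kronecker_iff_partition[OF sets.empty_sets]
    by (intro allI impI exI[of _ "\<lambda>_. 0"]) (auto simp: L2_dist_def koopman_def image_constant_conv)
qed (rule kronecker_Compl kronecker_UN, assumption)+

lemma sets_directional_kronecker:
  "sets (directional_kronecker M T \<beta> b) = directional_kronecker_sets M T \<beta> b"
  by (simp add: directional_kronecker_def sigma_algebra.sets_measure_of_eq[OF sigma_algebra_kronecker])

lemma subalgebra_directional_kronecker: "subalgebra M (directional_kronecker M T \<beta> b)"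
  unfolding subalgebra_def sets_directional_kronecker
  by (auto simp: directional_kronecker_def directional_kronecker_sets_def space_measure_of_conv)

end

end

theory Submission
  imports Defs
begin

text \<open>Conditional expectation \<open>P\<close> onto a sub-sigma-algebra \<open>F\<close> of a
  finite measure space is the orthogonal projection of L2 onto its F-measurable functions, so L2
  splits into the kernel and the range of \<open>P\<close>. Three facts carry this: \<open>P\<close>
  maps L2 into itself (\<open>complex_cond_exp_L2\<close>), it fixes F-measurable functions
  (\<open>complex_cond_exp_F_meas\<close>), and \<open>f\<close> and \<open>P f\<close> have the
  same inner products with them (\<open>L2_inner_complex_cond_exp\<close>). For \<open>F\<close> the
  directional Kronecker algebra, the kernel is by definition the set of weakly mixing functions.

  Since \<open>complex_cond_exp\<close> acts on real and imaginary parts separately,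
  \<open>L2_iff_Re_Im\<close> reduces each fact to one about \<open>real_cond_exp\<close>.\<close>

lemma L2_iff_Re_Im:
  "f \<in> L2 M \<longleftrightarrow> (\<lambda>x. Re (f x)) \<in> borel_measurable M \<and> integrable M (\<lambda>x. (Re (f x))\<^sup>2) \<and>
     (\<lambda>x. Im (f x)) \<in> borel_measurable M \<and> integrable M (\<lambda>x. (Im (f x))\<^sup>2)"
proof
  assume f: "f \<in> L2 M"
  note [measurable] = L2_measurable[OF f]
  have "integrable M (\<lambda>x. (Re (f x))\<^sup>2)" "integrable M (\<lambda>x. (Im (f x))\<^sup>2)"
    by (rule Bochner_Integration.integrable_bound[OF L2_integrable[OF f]];
        force simp: cmod_power2)+
  then show "(\<lambda>x. Re (f x)) \<in> borel_measurable M \<and> integrable M (\<lambda>x. (Re (f x))\<^sup>2) \<and>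
     (\<lambda>x. Im (f x)) \<in> borel_measurable M \<and> integrable M (\<lambda>x. (Im (f x))\<^sup>2)"
    by simp
qed (auto simp: L2_def cmod_power2 borel_measurable_complex_iff)

lemma L2_add:
  assumes f: "f \<in> L2 M" and g: "g \<in> L2 M"
  shows "(\<lambda>x. f x + g x) \<in> L2 M"
proof -
  have "(\<lambda>x. 0 - g x) \<in> L2 M"
    using g by (simp add: L2_def)
  from L2_diff[OF f this] show ?thesis by simp
qed

lemma L2_scale: "f \<in> L2 M \<Longrightarrow> (\<lambda>x. c * f x) \<in> L2 M"
  by (auto simp: L2_def norm_mult power_mult_distrib)

lemma integrable_mult_square_integrable:
  fixes u v :: "'a \<Rightarrow> real"
  assumes [measurable]: "u \<in> borel_measurable M" "v \<in> borel_measurable M"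
    and "integrable M (\<lambda>x. (u x)\<^sup>2)" "integrable M (\<lambda>x. (v x)\<^sup>2)"
  shows "integrable M (\<lambda>x. u x * v x)"
proof -
  \<comment> \<open>\<open>Cauchy_Schwarz_integral\<close> is stated for nonnegative functions,
    hence the absolute values.\<close>
  have "integrable M (\<lambda>x. \<bar>u x\<bar> * \<bar>v x\<bar>)"
    using assms by (intro Cauchy_Schwarz_integral(1)) auto
  then have "integrable M (\<lambda>x. \<bar>u x * v x\<bar>)"
    by (simp add: abs_mult)
  then show ?thesis
    by (subst (asm) integrable_abs_iff) simp_all
qed

lemma L2_subspace_L2: "L2_subspace M (L2 M)"
  by (auto simp: L2_subspace_def L2_add L2_scale) (simp add: L2_def)

text \<open>For F-measurable functions, integrability does not change when the measure is restricted
  to \<open>F\<close>. The second summand thereby becomes a set of functions on \<open>M\<close>,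
  where both summands can be compared.\<close>

lemma L2_restr_to_subalg:
  assumes F: "subalgebra M F"
  shows "L2 (restr_to_subalg M F) = L2 M \<inter> borel_measurable F"
proof (intro equalityI subsetI)
  fix f assume f: "f \<in> L2 (restr_to_subalg M F)"
  then have "f \<in> borel_measurable F"
    by (auto intro: measurable_in_subalg'[OF F] L2_measurable)
  with F f show "f \<in> L2 M \<inter> borel_measurable F"
    by (auto simp: L2_def intro: integrable_from_subalg measurable_from_subalg)
next
  fix f assume f: "f \<in> L2 M \<inter> borel_measurable F"
  then have [measurable]: "f \<in> borel_measurable F" by simp
  show "f \<in> L2 (restr_to_subalg M F)"
    unfolding L2_def using f
    by (auto intro!: integrable_in_subalg[OF F] measurable_in_subalg[OF F] dest: L2_integrable)
qed

context finite_measure_subalgebra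
begin

lemma L2_integrable_Re_Im:
  assumes "f \<in> L2 M"
  shows "integrable M (\<lambda>x. Re (f x))" "integrable M (\<lambda>x. Im (f x))"
  using assms by (auto simp: L2_iff_Re_Im intro: square_integrable_imp_integrable)

text \<open>Conditional Jensen inequality for the convex function \<open>x\<^sup>2\<close>.\<close>

lemma real_cond_exp_square_integrable:
  assumes "integrable M u" "integrable M (\<lambda>x. (u x)\<^sup>2)"
  shows "integrable M (\<lambda>x. (real_cond_exp M F u x)\<^sup>2)"
  using assms
  by (intro integrable_convex_cond_exp[where I = UNIV and X = u and q = "\<lambda>x. x\<^sup>2"])
     (auto intro!: convex_on_realI[where f' = "\<lambda>x. 2 * x"] derivative_eq_intros)

lemma complex_cond_exp_measurable:
  "complex_cond_exp M F f \<in> borel_measurable F"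
  by (simp add: complex_cond_exp_def borel_measurable_complex_iff)

lemma complex_cond_exp_L2:
  assumes "f \<in> L2 M"
  shows "complex_cond_exp M F f \<in> L2 M"
  using assms L2_integrable_Re_Im[OF assms]
  by (auto simp: L2_iff_Re_Im complex_cond_exp_def intro: real_cond_exp_square_integrable)

lemma complex_cond_exp_add:
  assumes "f \<in> L2 M" "g \<in> L2 M"
  shows "AE x in M. complex_cond_exp M F (\<lambda>x. f x + g x) x
    = complex_cond_exp M F f x + complex_cond_exp M F g x"
  using real_cond_exp_add[OF assms[THEN L2_integrable_Re_Im(1)]]
    real_cond_exp_add[OF assms[THEN L2_integrable_Re_Im(2)]]
  by eventually_elim (simp add: complex_cond_exp_def complex_eq_iff)

text \<open>A complex factor mixes the components: Re(c f) = Re c Re f - Im c Im f and Im(c f) = Re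
  c Im f + Im c Re f. Real linearity is therefore applied to both combinations.\<close>

lemma complex_cond_exp_scale:
  assumes "f \<in> L2 M"
  shows "AE x in M. complex_cond_exp M F (\<lambda>x. c * f x) x = c * complex_cond_exp M F f x"
proof -
  note R = L2_integrable_Re_Im(1)[OF assms] and I = L2_integrable_Re_Im(2)[OF assms]
  note m = integrable_mult_right
  show ?thesis
    using real_cond_exp_diff[OF m[OF R] m[OF I], of "Re c" "Im c"]
      real_cond_exp_add[OF m[OF I] m[OF R], of "Re c" "Im c"]
      real_cond_exp_cmult[OF R, of "Re c"] real_cond_exp_cmult[OF R, of "Im c"]
      real_cond_exp_cmult[OF I, of "Re c"] real_cond_exp_cmult[OF I, of "Im c"]
    by eventually_elim (simp add: complex_cond_exp_def complex_eq_iff)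
qed

lemma complex_cond_exp_F_meas:
  assumes f: "f \<in> L2 M" and [measurable]: "f \<in> borel_measurable F"
  shows "AE x in M. complex_cond_exp M F f x = f x"
proof -
  have Re: "AE x in M. real_cond_exp M F (\<lambda>x. Re (f x)) x = Re (f x)"
    by (rule real_cond_exp_F_meas[OF L2_integrable_Re_Im(1)[OF f]]) measurable
  have Im: "AE x in M. real_cond_exp M F (\<lambda>x. Im (f x)) x = Im (f x)"
    by (rule real_cond_exp_F_meas[OF L2_integrable_Re_Im(2)[OF f]]) measurable
  from Re Im show ?thesis
    by eventually_elim (simp add: complex_cond_exp_def complex_eq_iff)
qed

text \<open>An F-measurable factor can be moved into the conditional expectation, which preserves
  integrals. This is applied to the four real products that make up the inner product; in other
  words, f - P f is orthogonal to every F-measurable \<open>h\<close> in L2.\<close>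

lemma L2_inner_complex_cond_exp:
  assumes f: "f \<in> L2 M" and h: "h \<in> L2 M" and hF [measurable]: "h \<in> borel_measurable F"
  shows "L2_inner M (complex_cond_exp M F f) h = L2_inner M f h"
proof -
  let ?E = "real_cond_exp M F"
  note f' = f[unfolded L2_iff_Re_Im] and h' = h[unfolded L2_iff_Re_Im]
  have hF': "(\<lambda>x. Re (h x)) \<in> borel_measurable F" "(\<lambda>x. Im (h x)) \<in> borel_measurable F"
    by measurable
  have prod: "integrable M (\<lambda>x. Re (h x) * Re (f x))" "integrable M (\<lambda>x. Re (h x) * Im (f x))"
    "integrable M (\<lambda>x. Im (h x) * Re (f x))" "integrable M (\<lambda>x. Im (h x) * Im (f x))"
    using f' h' by (auto intro: integrable_mult_square_integrable)
  \<comment> \<open>Kept general in \<open>g\<close> because it serves for both \<open>f\<close> and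
    its conditional expectation. The factor from \<open>h\<close> comes first to match
    \<open>real_cond_exp_intg\<close>.\<close>
  have expand: "L2_inner M g h
      = Complex ((LINT x|M. Re (h x) * Re (g x)) + (LINT x|M. Im (h x) * Im (g x)))
          ((LINT x|M. Re (h x) * Im (g x)) - (LINT x|M. Im (h x) * Re (g x)))"
    if "integrable M (\<lambda>x. Re (h x) * Re (g x))" "integrable M (\<lambda>x. Re (h x) * Im (g x))"
      "integrable M (\<lambda>x. Im (h x) * Re (g x))" "integrable M (\<lambda>x. Im (h x) * Im (g x))" for g
  proof -
    have eq: "g x * cnj (h x) = complex_of_real (Re (h x) * Re (g x) + Im (h x) * Im (g x))
        + \<i> * complex_of_real (Re (h x) * Im (g x) - Im (h x) * Re (g x))" for x
      by (simp add: complex_eq_iff algebra_simps)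
    show ?thesis
      unfolding L2_inner_def eq using that
      by (subst Bochner_Integration.integral_add)
         (simp_all add: complex_eq_iff del: of_real_add of_real_diff of_real_mult)
  qed
  have [measurable]: "(\<lambda>x. Re (f x)) \<in> borel_measurable M" "(\<lambda>x. Im (f x)) \<in> borel_measurable M"
    using f' by auto
  show ?thesis
    using prod f' hF' by (subst (1 2) expand) (simp_all add: complex_cond_exp_def real_cond_exp_intg)
qed

text \<open>The decomposition is f = (f - P f) + P f.\<close>

theorem L2_orthogonal_direct_sum_cond_exp:
  "L2_orthogonal_direct_sum M {f \<in> L2 M. AE x in M. complex_cond_exp M F f x = 0}
     (L2 (restr_to_subalg M F))" (is "L2_orthogonal_direct_sum M ?V ?W")
  unfolding L2_orthogonal_direct_sum_def
proof (intro conjI ballI)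
  let ?P = "complex_cond_exp M F"
  have W: "?W = L2 M \<inter> borel_measurable F"
    by (rule L2_restr_to_subalg[OF subalg])
  have zero: "(\<lambda>x. 0) \<in> L2 M" by (simp add: L2_def)
  show "L2_subspace M ?V"
    unfolding L2_subspace_def
  proof (intro conjI ballI allI)
    show "(\<lambda>x. 0) \<in> ?V"
      using zero complex_cond_exp_F_meas[OF zero] by simp
    show "(\<lambda>x. f x + g x) \<in> ?V" if "f \<in> ?V" "g \<in> ?V" for f g
      using that complex_cond_exp_add[of f g] by (auto simp: L2_add)
    show "(\<lambda>x. c * f x) \<in> ?V" if "f \<in> ?V" for c f
      using that complex_cond_exp_scale[of f c] by (auto simp: L2_scale)
  qed auto
  show "L2_subspace M ?W"
    using L2_subspace_L2[of M] unfolding W L2_subspace_def by auto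
  show "L2_inner M g h = 0" if g: "g \<in> ?V" and h: "h \<in> ?W" for g h
  proof -
    have [measurable]: "?P g \<in> borel_measurable M" "h \<in> borel_measurable M"
      using g h by (auto simp: W intro!: L2_measurable complex_cond_exp_L2)
    have [measurable]: "(\<lambda>x. cnj (h x)) \<in> borel_measurable M"
      by (simp add: borel_measurable_complex_iff)
    \<comment> \<open>Since \<open>h\<close> is F-measurable, \<open>g\<close> may be replaced by
      its conditional expectation, which vanishes almost everywhere.\<close>
    have "L2_inner M g h = L2_inner M (?P g) h"
      using g h by (simp add: W L2_inner_complex_cond_exp)
    also have "\<dots> = (LINT x|M. 0)"
      unfolding L2_inner_def using g by (intro integral_cong_AE) auto
    finally show ?thesis by simp
  qed
  fix f assume f: "f \<in> L2 M"
  let ?g = "\<lambda>x. f x - ?P f x"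
  have Pf: "?P f \<in> ?W"
    using f by (simp add: W complex_cond_exp_L2 complex_cond_exp_measurable)
  then have PL: "?P f \<in> L2 M" by (simp add: W)
  have g: "?g \<in> L2 M" by (rule L2_diff[OF f PL])
  \<comment> \<open>Additivity on f = g + P f gives P f = P g + P (P f), and P (P f) = P f, so P g =
    0 almost everywhere.\<close>
  have gV: "?g \<in> ?V"
    using g complex_cond_exp_add[OF g PL] complex_cond_exp_F_meas[OF PL complex_cond_exp_measurable]
    by auto
  \<comment> \<open>Applying \<open>P\<close> to f = g' + h' kills g' and fixes h', so h' = P f
    almost everywhere; then g' is determined by subtraction.\<close>
  have uniq: "(AE x in M. g' x = ?g x) \<and> (AE x in M. h' x = ?P f x)"
    if g': "g' \<in> ?V" and h': "h' \<in> ?W" and eq: "AE x in M. f x = g' x + h' x" for g' h'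
  proof -
    have L: "g' \<in> L2 M" "h' \<in> L2 M" "h' \<in> borel_measurable F" using g' h' by (auto simp: W)
    note [measurable] = L2_measurable[OF f] L2_measurable[OF L(1)] L2_measurable[OF L(2)]
    have "AE x in M. real_cond_exp M F (\<lambda>x. Re (f x)) x = real_cond_exp M F (\<lambda>x. Re (g' x + h' x)) x"
      by (rule real_cond_exp_cong) (use eq in \<open>auto elim: eventually_mono\<close>)
    moreover have "AE x in M. real_cond_exp M F (\<lambda>x. Im (f x)) x = real_cond_exp M F (\<lambda>x. Im (g' x + h' x)) x"
      by (rule real_cond_exp_cong) (use eq in \<open>auto elim: eventually_mono\<close>)
    ultimately have "AE x in M. ?P f x = ?P (\<lambda>x. g' x + h' x) x"
      by eventually_elim (simp add: complex_cond_exp_def)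
    moreover have "AE x in M. ?P g' x = 0" using g' by simp
    ultimately have "AE x in M. h' x = ?P f x"
      using complex_cond_exp_add[OF L(1,2)] complex_cond_exp_F_meas[OF L(2,3)]
      by eventually_elim simp
    moreover from this eq have "AE x in M. g' x = ?g x" by eventually_elim simp
    ultimately show ?thesis by simp
  qed
  show "\<exists>g\<in>?V. \<exists>h\<in>?W. (AE x in M. f x = g x + h x) \<and>
      (\<forall>g'\<in>?V. \<forall>h'\<in>?W. (AE x in M. f x = g' x + h' x) \<longrightarrow>
         (AE x in M. g' x = g x) \<and> (AE x in M. h' x = h x))"
    by (rule bexI[OF bexI[OF _ Pf] gV]) (use uniq in auto)
qed

end

theorem theorem3p11:
  fixes M :: "'a::metric_space measure"
    and T :: "int \<times> int \<Rightarrow> 'a \<Rightarrow> 'a"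
    and \<beta> b :: real
  assumes "Z2_mps M T"
    and "\<beta> \<notin> \<rat>"
    and "0 < b"
  shows "L2_orthogonal_direct_sum M (directional_weak_mixing M T \<beta> b)
           (L2 (restr_to_subalg M (directional_kronecker M T \<beta> b)))"
proof -
  interpret Z2_mps M T by fact
  \<comment> \<open>The Kronecker sets form a sigma-algebra inside \<open>sets M\<close>, so the
    general decomposition applies with \<open>F\<close> the Kronecker algebra.\<close>
  interpret finite_measure_subalgebra M "directional_kronecker M T \<beta> b"
    by standard (rule subalgebra_directional_kronecker)
  show ?thesis
    unfolding directional_weak_mixing_def by (rule L2_orthogonal_direct_sum_cond_exp)
qed

end
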